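(* Let $(X_u)_{u\in\mathcal T_\infty}$ be the vertex reinforced branching random walk (VRBRW) on $\mathbb Z$ with offspring distribution $\mu$ and non-decreasing weight function $w:\mathbb N\to(0,\infty)$, and let $\mathcal R'=\{x\in\mathbb Z: Z_\infty(x)=\infty\}$ be the set of sites visited infinitely often. If $\sum_{n\ge 0}\frac{1}{w(n)}=\infty$, then $$\mathbb P(|\mathcal R'|\in\{2,3\})=0.$$
   Context: $\mathbb N=\{0,1,2,\dots\}$. Let $\mu$ be a probability measure on $\mathbb N$ with mean one and variance $\sigma^2=\sum_{i\ge1} i(i-1)\mu(i)\in(0,\infty)$. Kesten's tree $\mathcal T_\infty$ associated with $\mu$: vertices are either normal or special; all vertices reproduce independently; normal vertices have a number of children with law $\mu$, all normal; special vertices have a number of children with the size-biased law $\widetilde\mu(i)=i\mu(i)$, and among the children of a special vertex one chosen uniformly at random is special while the others are normal. The root $\emptyset$ is special. For $u\in\mathcal T_\infty$, $|u|$ is its generation (with $|\emptyset|=0$) and $\mathcal V(u)$ is its set of children. Set $\mathcal T_n=\{u\in\mathcal T_\infty:|u|\le n\}$ and $\partial\mathcal T_n=\{u\in\mathcal T_\infty:|u|=n\}$. VRBRW on $\mathbb Z$: let $w:\mathbb N\to(0,\infty)$ be non-decreasing (the weight function). The process $(X_u)_{u\in\mathcal T_\infty}$ takes values in $\mathbb Z$, with $X_\emptyset=0$. For $n\in\mathbb N\cup\{\infty\}$ and $x\in\mathbb Z$ the local time is $Z_n(x)=\sum_{u\in\mathcal T_n}\mathbf 1\{X_u=x\}$.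 Let $\mathcal F_n=\sigma(\mathcal T_n,(X_u)_{u\in\mathcal T_n})$. Conditionally on $\mathcal F_n$ and on the tree, the positions of the vertices of generation $n+1$ are independent, and for $u\in\partial\mathcal T_n$, $v\in\mathcal V(u)$, on the event $\{X_u=x\}$, $$\mathbb P(X_v=x\pm1\mid\mathcal F_n,\mathcal V(u))=\frac{w(Z_n(x\pm1))}{w(Z_n(x-1))+w(Z_n(x+1))}.$$ *)

theory Defs
  imports "HOL-Probability.Probability"
begin

section \<open>Ordered trees\<close>

text \<open>
  Vertices are Ulam--Harris words: the root is \<^term>\<open>[]\<close>, the children of a vertex \<open>u\<close> are
  \<open>u @ [0], \<dots>, u @ [k - 1]\<close>, and the generation of \<open>u\<close> is its length.
\<close>

definition children :: "nat list set \<Rightarrow> nat list \<Rightarrow> nat list set" where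
  "children t u = {v \<in> t. \<exists>i. v = u @ [i]}"

definition ordered_tree :: "nat list set \<Rightarrow> bool" where
  "ordered_tree t \<longleftrightarrow>
     [] \<in> t \<and> (\<forall>u i. u @ [i] \<in> t \<longrightarrow> u \<in> t) \<and>
     (\<forall>u \<in> t. \<exists>k. children t u = {u @ [i] | i. i < k})"

definition up_to_gen :: "nat \<Rightarrow> nat list set \<Rightarrow> nat list set" where
  "up_to_gen n t = {u \<in> t. length u \<le> n}"

definition generation :: "nat \<Rightarrow> nat list set \<Rightarrow> nat list set" where
  "generation n t = {u \<in> t. length u = n}"

lemma finite_generation:
  assumes "ordered_tree t"
  shows "finite (generation n t)"
proof (induction n)
  case 0
  have "generation 0 t \<subseteq> {[]}" by (auto simp: generation_def)
  then show ?case by (rule finite_subset) simp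
next
  case (Suc n)
  have fin: "finite (children t u)" if u: "u \<in> t" for u
  proof -
    obtain k where "children t u = {u @ [i] | i. i < k}"
      using assms u unfolding ordered_tree_def by blast
    then show ?thesis by simp
  qed
  have "generation (Suc n) t \<subseteq> (\<Union>u\<in>generation n t. children t u)"
  proof
    fix v assume v: "v \<in> generation (Suc n) t"
    then have "length v = Suc n" by (simp add: generation_def)
    then obtain u i where "v = u @ [i]" "length u = n"
      unfolding length_Suc_conv_rev by blast
    moreover from this v assms have "u \<in> generation n t" "v \<in> children t u"
      unfolding generation_def children_def ordered_tree_def by blast+
    ultimately show "v \<in> (\<Union>u\<in>generation n t. children t u)" by blast
  qed
  moreover have "finite (\<Union>u\<in>generation n t. children t u)"
    using Suc by (rule finite_UN_I) (use fin in \<open>simp add: generation_def\<close>)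
  ultimately show ?case by (rule finite_subset)
qed

lemma finite_up_to_gen:
  assumes "ordered_tree t"
  shows "finite (up_to_gen n t)"
proof -
  have "up_to_gen n t = (\<Union>k\<le>n. generation k t)"
    by (auto simp: up_to_gen_def generation_def)
  then show ?thesis using finite_generation[OF assms] by simp
qed


section \<open>Kesten's tree\<close>

text \<open>Only meaningful if \<open>\<mu>\<close> has mean one; see the lemma below.\<close>

definition size_biased :: "nat pmf \<Rightarrow> nat pmf" where
  "size_biased \<mu> = embed_pmf (\<lambda>i. real i * pmf \<mu> i)"

lemma pmf_size_biased:
  assumes "(\<lambda>i. real i * pmf \<mu> i) sums 1"
  shows "pmf (size_biased \<mu>) i = real i * pmf \<mu> i"
  unfolding size_biased_def
proof (rule pmf_embed_pmf)
  have "(\<integral>\<^sup>+x. ennreal (real x * pmf \<mu> x) \<partial>count_space UNIV) = (\<Sum>x. ennreal (real x * pmf \<mu> x))"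
    by (rule nn_integral_count_space_nat)
  also have "\<dots> = ennreal (\<Sum>x. real x * pmf \<mu> x)"
    using assms by (intro suminf_ennreal2) (auto simp: sums_iff)
  also have "\<dots> = 1" using assms by (simp add: sums_iff)
  finally show "(\<integral>\<^sup>+x. ennreal (real x * pmf \<mu> x) \<partial>count_space UNIV) = 1" .
qed simp

text \<open>
  The outcome of the reproduction of a vertex is a pair: its number of children, and the set of
  those \<open>i\<close> for which its \<open>i\<close>-th child is special.
\<close>

definition normal_reproduction :: "nat pmf \<Rightarrow> (nat \<times> nat set) pmf" where
  "normal_reproduction \<mu> = map_pmf (\<lambda>k. (k, {})) \<mu>"

definition special_reproduction :: "nat pmf \<Rightarrow> (nat \<times> nat set) pmf" where
  "special_reproduction \<mu> =
     bind_pmf (size_biased \<mu>) (\<lambda>k. map_pmf (\<lambda>i. (k, {i})) (pmf_of_set {..<k}))"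

definition reproduction :: "nat list set \<Rightarrow> nat list set \<Rightarrow> nat list \<Rightarrow> nat \<times> nat set" where
  "reproduction t s u = (card (children t u), {i. u @ [i] \<in> s})"

text \<open>
  \<open>T\<close> is the random tree and \<open>S\<close> its random set of special vertices. The law is given generation
  by generation: conditionally on the tree and the types of its vertices up to generation \<open>n\<close>
  (which take countably many values), the vertices of generation \<open>n\<close> reproduce independently, with
  the law prescribed by their type. When \<open>t\<close> and \<open>s\<close> are not possible values, both sides vanish.
\<close>

locale kesten_tree = prob_space M
  for M :: "'a measure" +
  fixes \<mu> :: "nat pmf"
    and T :: "'a \<Rightarrow> nat list set"
    and S :: "'a \<Rightarrow> nat list set"
  assumes ordered_tree: "\<And>\<omega>. \<omega> \<in> space M \<Longrightarrow> ordered_tree (T \<omega>)"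
    and special_vertices: "\<And>\<omega>. \<omega> \<in> space M \<Longrightarrow> S \<omega> \<subseteq> T \<omega>"
    and special_root: "\<And>\<omega>. \<omega> \<in> space M \<Longrightarrow> [] \<in> S \<omega>"
    and tree_event: "\<And>u. {\<omega> \<in> space M. u \<in> T \<omega>} \<in> sets M"
    and special_event: "\<And>u. {\<omega> \<in> space M. u \<in> S \<omega>} \<in> sets M"
    and reproduction_law:
      "\<And>n t s r.
        prob {\<omega> \<in> space M. up_to_gen n (T \<omega>) = t \<and> up_to_gen n (S \<omega>) = s \<and>
                (\<forall>u \<in> generation n t. reproduction (T \<omega>) (S \<omega>) u = r u)}
        = prob {\<omega> \<in> space M. up_to_gen n (T \<omega>) = t \<and> up_to_gen n (S \<omega>) = s} *
          (\<Prod>u \<in> generation n t.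
             pmf (if u \<in> s then special_reproduction \<mu> else normal_reproduction \<mu>) (r u))"


section \<open>Local times\<close>

text \<open>Here \<open>x u\<close> is the position of the vertex \<open>u\<close>; it is irrelevant for \<open>u\<close> outside \<open>t\<close>.\<close>

definition local_time :: "nat list set \<Rightarrow> (nat list \<Rightarrow> int) \<Rightarrow> nat \<Rightarrow> int \<Rightarrow> nat" where
  "local_time t x n y = (\<Sum>u \<in> up_to_gen n t. of_bool (x u = y))"

definition total_local_time :: "nat list set \<Rightarrow> (nat list \<Rightarrow> int) \<Rightarrow> int \<Rightarrow> ennreal" where
  "total_local_time t x y = (\<Sum>\<^sub>\<infinity>u \<in> t. of_bool (x u = y))"

definition infinitely_visited :: "nat list set \<Rightarrow> (nat list \<Rightarrow> int) \<Rightarrow> int set" where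
  "infinitely_visited t x = {y. total_local_time t x y = \<infinity>}"

lemma infinitely_visited_iff:
  "y \<in> infinitely_visited t x \<longleftrightarrow> infinite {u \<in> t. x u = y}"
proof -
  let ?A = "{u \<in> t. x u = y}"
  have 1: "total_local_time t x y = (\<Sum>\<^sub>\<infinity>u \<in> ?A. (1::ennreal))"
    unfolding total_local_time_def by (rule infsum_cong_neutral) (simp_all, blast)
  show ?thesis
  proof (cases "finite ?A")
    case True
    then show ?thesis using 1 by (simp add: infinitely_visited_def)
  next
    case False
    have "(\<Sum>\<^sub>\<infinity>u \<in> ?A. (1::ennreal)) = \<infinity>"
      by (rule infsum_superconst_infinite_ennreal[where b = 1]) (use False in auto)
    then show ?thesis using 1 False by (simp add: infinitely_visited_def)
  qed
qed


section \<open>The vertex reinforced branching random walk\<close>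

definition step_prob :: "(nat \<Rightarrow> real) \<Rightarrow> (int \<Rightarrow> nat) \<Rightarrow> int \<Rightarrow> int \<Rightarrow> real" where
  "step_prob w z x y =
     (if y = x - 1 \<or> y = x + 1 then w (z y) / (w (z (x - 1)) + w (z (x + 1))) else 0)"

text \<open>
  The \<open>\<sigma>\<close>-algebra generated by the whole tree and by the positions of its vertices up to
  generation \<open>n\<close>.
\<close>

definition past_algebra ::
  "'a measure \<Rightarrow> ('a \<Rightarrow> nat list set) \<Rightarrow> ('a \<Rightarrow> nat list \<Rightarrow> int) \<Rightarrow> nat \<Rightarrow> 'a measure" where
  "past_algebra M T X n = sigma (space M)
     ({{\<omega> \<in> space M. u \<in> T \<omega>} | u. True} \<union>
      {{\<omega> \<in> space M. u \<in> T \<omega> \<and> X \<omega> u = x} | u x. length u \<le> n})"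

text \<open>
  The conditional joint law of the positions in generation \<open>n + 1\<close> is given through the finite
  sets \<open>A\<close> of words of length \<open>n + 1\<close>, on the event that \<open>A\<close> consists of vertices of the tree.
  The parent of a vertex \<open>v\<close> is \<^term>\<open>butlast v\<close>. The product expresses conditional independence.
\<close>

locale vrbrw = kesten_tree M \<mu> T S
  for M :: "'a measure" and \<mu> :: "nat pmf" and T S :: "'a \<Rightarrow> nat list set" +
  fixes w :: "nat \<Rightarrow> real"
    and X :: "'a \<Rightarrow> nat list \<Rightarrow> int"
  assumes position_event: "\<And>u x. {\<omega> \<in> space M. u \<in> T \<omega> \<and> X \<omega> u = x} \<in> sets M"
    and position_root: "\<And>\<omega>. \<omega> \<in> space M \<Longrightarrow> X \<omega> [] = 0"
    and step_law:
      "\<And>n A y. finite A \<Longrightarrow> (\<And>v. v \<in> A \<Longrightarrow> length v = Suc n) \<Longrightarrow>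
        AE \<omega> in M. A \<subseteq> T \<omega> \<longrightarrow>
          real_cond_exp M (past_algebra M T X n)
            (indicator {\<omega>' \<in> space M. A \<subseteq> T \<omega>' \<and> (\<forall>v \<in> A. X \<omega>' v = y v)}) \<omega>
          = (\<Prod>v \<in> A. step_prob w (local_time (T \<omega>) (X \<omega>) n) (X \<omega> (butlast v)) (y v))"
begin

lemma subalgebra_past: "subalgebra M (past_algebra M T X n)"
proof -
  let ?G = "{{\<omega> \<in> space M. u \<in> T \<omega>} | u. True} \<union>
      {{\<omega> \<in> space M. u \<in> T \<omega> \<and> X \<omega> u = x} | u x. length u \<le> n}"
  have G: "?G \<subseteq> sets M" using tree_event position_event by auto
  have P: "?G \<subseteq> Pow (space M)" using G sets.space_closed by (rule subset_trans)
  show ?thesis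
    unfolding subalgebra_def past_algebra_def space_measure_of[OF P] sets_measure_of[OF P]
    using sets.sigma_sets_subset[OF G] by (rule conjI[OF refl])
qed

end

end

theory Submission
  imports Defs
begin

text \<open>
  Almost surely, if a site \<open>a\<close> is visited infinitely often, then so is \<open>a - 2\<close> or \<open>a + 2\<close>. Indeed,
  every visit to \<open>a\<close> in generation \<open>n + 1\<close> is made by a child of a vertex at \<open>a - 1\<close> or \<open>a + 1\<close>,
  which given the past could have jumped to \<open>a - 2\<close> or \<open>a + 2\<close> with probability at least
  \<open>w 0 / (w 0 + w k)\<close>, where \<open>k\<close> is the local time at \<open>a\<close> in generation \<open>n\<close>. As \<open>w\<close> is
  non-decreasing, these probabilities add up to at least \<open>\<Sum>k. w 0 / (w 0 + w k) = \<infinity>\<close>, and a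
  conditional Borel--Cantelli argument applies. Moreover, by finite branching, a site visited
  infinitely often has a neighbour visited infinitely often. No set of two or three integers is
  closed in both senses.
\<close>

section \<open>Random finite sets, a summation estimate, and sets of integers\<close>

text \<open>A countable type has only countably many finite subsets, so it suffices that each event
  \<open>F \<omega> = K\<close> is measurable, and this is a countable intersection of conditions on
  membership.\<close>

lemma measurable_finite_set_valued:
  fixes F :: "'a \<Rightarrow> 'b :: countable set"
  assumes [measurable]: "\<And>v. Measurable.pred N (\<lambda>\<omega>. v \<in> F \<omega>)"
    and fin: "\<And>\<omega>. \<omega> \<in> space N \<Longrightarrow> finite (F \<omega>)"
  shows "F \<in> measurable N (count_space {K. finite K})"
proof -
  have "F -` {K} \<inter> space N \<in> sets N" for K
  proof -
    have "F -` {K} \<inter> space N = {\<omega> \<in> space N. \<forall>v. v \<in> F \<omega> \<longleftrightarrow> v \<in> K}" by auto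
    also have "\<dots> \<in> sets N" by measurable
    finally show ?thesis .
  qed
  then show ?thesis
    using fin by (subst measurable_count_space_eq_countable) (auto intro: countable_Collect_finite)
qed

text \<open>The step from \<open>z n\<close> to \<open>z (Suc n)\<close> consumes at most
  \<open>b n\<close> terms, each at most \<open>g (z n)\<close> since \<open>g\<close> decreases.
  With \<open>z\<close> a local time and \<open>b\<close> the number of possible new visitors, this
  carries divergence of a series indexed by local time over to one indexed by generations.\<close>

lemma sum_le_antimono_partial_sums:
  fixes g :: "nat \<Rightarrow> real" and z b :: "nat \<Rightarrow> nat"
  assumes "antimono g" "\<And>k. g k \<ge> 0"
    and "\<And>n. z n \<le> z (Suc n)" "\<And>n. z (Suc n) \<le> z n + b n" and "m \<le> k"
  shows "(\<Sum>j = z m..<z k. g j) \<le> (\<Sum>n = m..<k. real (b n) * g (z n))"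
  using \<open>m \<le> k\<close>
proof (induction k rule: dec_induct)
  case base
  then show ?case by simp
next
  case (step k)
  have "z m \<le> z k" using step(1) assms(3) by (rule lift_Suc_mono_le[rotated])
  have "(\<Sum>j = z m..<z (Suc k). g j) = (\<Sum>j = z m..<z k. g j) + (\<Sum>j = z k..<z (Suc k). g j)"
    using \<open>z m \<le> z k\<close> assms(3) by (simp add: sum.atLeastLessThan_concat)
  also have "(\<Sum>j = z k..<z (Suc k). g j) \<le> (\<Sum>j = z k..<z (Suc k). g (z k))"
    using assms(1) by (intro sum_mono) (auto dest: antimonoD)
  also have "\<dots> = real (z (Suc k) - z k) * g (z k)" by simp
  also have "\<dots> \<le> real (b k) * g (z k)"
    using assms(2,4)[of "k"] assms(2) by (intro mult_right_mono) (auto simp: le_diff_conv add.commute)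
  finally show ?case using step by simp
qed

text \<open>Minimality of \<open>m\<close> forces \<open>m + 1\<close> and \<open>m + 2\<close> into
  \<open>R\<close>. With at most three elements, \<open>R\<close> consists of these three points,
  and the middle one violates \<open>two\<close>.\<close>

lemma card_closed_neighbours_not_2_3:
  fixes R :: "int set"
  assumes one: "\<And>x. x \<in> R \<Longrightarrow> x - 1 \<in> R \<or> x + 1 \<in> R"
    and two: "\<And>x. x \<in> R \<Longrightarrow> x - 2 \<in> R \<or> x + 2 \<in> R"
  shows "card R \<notin> {2, 3}"
proof
  assume card: "card R \<in> {2, 3}"
  then have fin: "finite R" and ne: "R \<noteq> {}" by (auto intro: card_ge_0_finite)
  define m where "m = Min R"
  have least: "m \<le> x" if "x \<in> R" for x
    using fin that by (simp add: m_def)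
  have "m \<in> R" using fin ne by (simp add: m_def)
  have "m + 1 \<in> R" "m + 2 \<in> R"
    using one[OF \<open>m \<in> R\<close>] two[OF \<open>m \<in> R\<close>] least[of "m - 1"] least[of "m - 2"] by auto
  then have sub: "{m, m + 1, m + 2} \<subseteq> R" using \<open>m \<in> R\<close> by simp
  have "card R \<le> card {m, m + 1, m + 2}" using card by auto
  then have "R = {m, m + 1, m + 2}" using card_seteq[OF fin sub] by simp
  then show False using two[of "m + 1"] by simp
qed

section \<open>Deterministic properties of trees and local times\<close>

text \<open>By finite branching only finitely many vertices lie up to a given generation, so an
  infinite set of vertices must reach arbitrarily late ones.\<close>

lemma infinite_iff_unbounded_generation:
  assumes "ordered_tree t"
  shows "infinite {u \<in> t. P u} \<longleftrightarrow> (\<forall>n. \<exists>u \<in> t. P u \<and> n \<le> length u)"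
proof
  assume inf: "infinite {u \<in> t. P u}"
  show "\<forall>n. \<exists>u \<in> t. P u \<and> n \<le> length u"
  proof (rule ccontr)
    assume "\<not> ?thesis"
    then obtain n where "\<forall>u\<in>t. P u \<longrightarrow> \<not> n \<le> length u" by blast
    then have "{u \<in> t. P u} \<subseteq> up_to_gen n t" by (auto simp: up_to_gen_def)
    then show False using inf finite_up_to_gen[OF assms] finite_subset by blast
  qed
next
  assume unb: "\<forall>n. \<exists>u \<in> t. P u \<and> n \<le> length u"
  show "infinite {u \<in> t. P u}"
  proof
    assume fin: "finite {u \<in> t. P u}"
    obtain u where "u \<in> t" "P u" "Suc (Max (length ` {u \<in> t. P u})) \<le> length u" using unb by blast
    moreover from this fin have "length u \<le> Max (length ` {u \<in> t. P u})" by (intro Max_ge) auto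
    ultimately show False by simp
  qed
qed

lemma butlast_in_tree:
  assumes "ordered_tree t" "v \<in> t" "v \<noteq> []"
  shows "butlast v \<in> t"
  using assms unfolding ordered_tree_def by (metis append_butlast_last_id)

text \<open>The conjuncts are arranged so that membership is literally the condition treated in
  \<open>pred_position_past\<close>.\<close>

definition visits :: "nat list set \<Rightarrow> (nat list \<Rightarrow> int) \<Rightarrow> nat \<Rightarrow> int \<Rightarrow> nat list set" where
  "visits t x n a = {u. length u \<le> n \<and> u \<in> t \<and> x u = a}"

text \<open>The candidates for a new visit to \<open>a\<close> in generation \<open>n + 1\<close>.
  Only the positions of their parents enter, so the set is determined by the tree and the positions
  up to generation \<open>n\<close>.\<close>

definition neighbour_offspring ::
  "nat list set \<Rightarrow> (nat list \<Rightarrow> int) \<Rightarrow> nat \<Rightarrow> int \<Rightarrow> nat list set" where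
  "neighbour_offspring t x n a =
     {v \<in> t. length v = Suc n \<and> (x (butlast v) = a - 1 \<or> x (butlast v) = a + 1)}"

definition nearest_neighbour :: "nat list set \<Rightarrow> (nat list \<Rightarrow> int) \<Rightarrow> bool" where
  "nearest_neighbour t x \<longleftrightarrow>
     (\<forall>v \<in> t. v \<noteq> [] \<longrightarrow> x v = x (butlast v) - 1 \<or> x v = x (butlast v) + 1)"

lemma finite_visits: "ordered_tree t \<Longrightarrow> finite (visits t x n a)"
  by (rule finite_subset[OF _ finite_up_to_gen[of t n]]) (auto simp: visits_def up_to_gen_def)

lemma finite_neighbour_offspring: "ordered_tree t \<Longrightarrow> finite (neighbour_offspring t x n a)"
  by (rule finite_subset[OF _ finite_generation[of t "Suc n"]])
    (auto simp: neighbour_offspring_def generation_def)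

lemma local_time_eq_card_visits:
  assumes "ordered_tree t"
  shows "local_time t x n a = card (visits t x n a)"
proof -
  have "local_time t x n a = card {u \<in> up_to_gen n t. x u = a}"
    unfolding local_time_def using finite_up_to_gen[OF assms] by (simp add: Int_def)
  also have "{u \<in> up_to_gen n t. x u = a} = visits t x n a"
    by (auto simp: visits_def up_to_gen_def)
  finally show ?thesis .
qed

lemma local_time_mono:
  assumes "ordered_tree t"
  shows "local_time t x n a \<le> local_time t x (Suc n) a"
  unfolding local_time_eq_card_visits[OF assms]
  using finite_visits[OF assms] by (rule card_mono) (auto simp: visits_def)

text \<open>A vertex at \<open>a\<close> in generation \<open>n + 1\<close> has its parent next to
  \<open>a\<close>, so every new visit is made by one of the candidates.\<close>

lemma local_time_Suc_le:
  assumes "ordered_tree t" "nearest_neighbour t x"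
  shows "local_time t x (Suc n) a \<le> local_time t x n a + card (neighbour_offspring t x n a)"
proof -
  have "visits t x (Suc n) a \<subseteq> visits t x n a \<union> neighbour_offspring t x n a"
  proof
    fix v assume v: "v \<in> visits t x (Suc n) a"
    show "v \<in> visits t x n a \<union> neighbour_offspring t x n a"
    proof (cases "length v = Suc n")
      case True
      with v assms(2) have "x v = x (butlast v) - 1 \<or> x v = x (butlast v) + 1"
        by (auto simp: visits_def nearest_neighbour_def)
      then show ?thesis using v True by (auto simp: visits_def neighbour_offspring_def)
    qed (use v in \<open>auto simp: visits_def\<close>)
  qed
  then have "card (visits t x (Suc n) a) \<le> card (visits t x n a \<union> neighbour_offspring t x n a)"
    using finite_visits[OF assms(1)] finite_neighbour_offspring[OF assms(1)]
    by (intro card_mono) auto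
  also have "\<dots> \<le> card (visits t x n a) + card (neighbour_offspring t x n a)" by (rule card_Un_le)
  finally show ?thesis by (simp add: local_time_eq_card_visits[OF assms(1)])
qed

lemma filterlim_local_time:
  assumes "ordered_tree t" "a \<in> infinitely_visited t x"
  shows "filterlim (\<lambda>n. local_time t x n a) at_top sequentially"
proof -
  have inf: "infinite {u \<in> t. x u = a}" using assms(2) by (simp add: infinitely_visited_iff)
  have "\<exists>n. N \<le> local_time t x n a" for N
  proof -
    obtain K where K: "finite K" "card K = N" "K \<subseteq> {u \<in> t. x u = a}"
      using infinite_arbitrarily_large[OF inf] by blast
    \<comment> \<open>The last generation among the \<open>N\<close> chosen visits. For
      \<open>N = 0\<close> this \<open>Max\<close> is unspecified, but the inclusion is
      trivial.\<close>
    have "K \<subseteq> visits t x (Max (length ` K)) a" using K by (auto simp: visits_def)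
    then show ?thesis
      using card_mono[OF finite_visits[OF assms(1)]] K(2)
      unfolding local_time_eq_card_visits[OF assms(1)] by blast
  qed
  moreover have "mono (\<lambda>n. local_time t x n a)"
    using local_time_mono[OF assms(1)] by (auto simp: mono_iff_le_Suc)
  ultimately show ?thesis
    unfolding filterlim_at_top eventually_sequentially by (meson le_trans monoD)
qed

text \<open>Otherwise both neighbours are vacant from generation \<open>n + m\<close> on, while a
  visitor of \<open>a\<close> in a later generation has its parent, only one generation earlier, on
  one of them.\<close>

lemma neighbour_infinitely_visited:
  assumes t: "ordered_tree t" and nn: "nearest_neighbour t x" and a: "a \<in> infinitely_visited t x"
  shows "a - 1 \<in> infinitely_visited t x \<or> a + 1 \<in> infinitely_visited t x"
proof (rule ccontr)
  assume "\<not> ?thesis"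
  then obtain n m where
    n: "\<And>u. u \<in> t \<Longrightarrow> x u = a - 1 \<Longrightarrow> length u < n" and
    m: "\<And>u. u \<in> t \<Longrightarrow> x u = a + 1 \<Longrightarrow> length u < m"
    unfolding infinitely_visited_iff infinite_iff_unbounded_generation[OF t]
    by (meson not_le)
  obtain v where v: "v \<in> t" "x v = a" "Suc (n + m) \<le> length v"
    using a unfolding infinitely_visited_iff infinite_iff_unbounded_generation[OF t] by blast
  then have "v \<noteq> []" by auto
  with v nn have "x (butlast v) = a - 1 \<or> x (butlast v) = a + 1"
    by (auto simp: nearest_neighbour_def)
  moreover have "butlast v \<in> t" using butlast_in_tree[OF t] v \<open>v \<noteq> []\<close> by blast
  ultimately show False using n[of "butlast v"] m[of "butlast v"] v(3) by auto
qed

text \<open>The competing site has weight at least \<open>w 0\<close>, so the probability is at most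
  \<open>1 - r\<close> with \<open>r = w 0 / (w 0 + w (z a))\<close>, and \<open>1 - r\<close> is at
  most \<open>exp (- r)\<close>. The exponential form turns products over vertices into
  sums.\<close>

lemma step_prob_le_exp:
  assumes "mono w" "\<And>n. w n > 0" and x: "x = a - 1 \<or> x = a + 1"
  shows "step_prob w z x a \<le> exp (- (w 0 / (w 0 + w (z a))))"
proof -
  have *: "w (z a) / (w (z b) + w (z a)) \<le> exp (- (w 0 / (w 0 + w (z a))))" for b
  proof -
    have "w (z a) / (w (z b) + w (z a)) \<le> w (z a) / (w 0 + w (z a))"
      using assms(2)[of 0] assms(2)[of "z a"] assms(1)
        monoD[OF assms(1), of 0 "z b"] assms(2)[of "z b"]
      by (intro divide_left_mono) auto
    also have "\<dots> = 1 + - (w 0 / (w 0 + w (z a)))"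
      using assms(2)[of 0] assms(2)[of "z a"] by (simp add: field_simps)
    also have "\<dots> \<le> exp (- (w 0 / (w 0 + w (z a))))" by (rule exp_ge_add_one_self)
    finally show ?thesis .
  qed
  show ?thesis using x *[of "x - 1"] *[of "x + 1"] by (auto simp: step_prob_def add.commute)
qed

section \<open>Measurability with respect to the past\<close>

context vrbrw
begin

abbreviation past :: "nat \<Rightarrow> 'a measure" where
  "past n \<equiv> past_algebra M T X n"

lemma space_past [simp]: "space (past n) = space M"
  using subalgebra_past by (simp add: subalgebra_def)

lemma sets_past: "A \<in> sets (past n) \<Longrightarrow> A \<in> sets M"
  using subalgebra_past by (auto simp only: subalgebra_def)

lemma measurable_past: "f \<in> measurable (past n) N \<Longrightarrow> f \<in> measurable M N"
  by (rule measurable_from_subalg[OF subalgebra_past])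

lemma past_generators:
  "{{\<omega> \<in> space M. u \<in> T \<omega>} | u. True} \<union>
   {{\<omega> \<in> space M. u \<in> T \<omega> \<and> X \<omega> u = x} | u x. length u \<le> n} \<subseteq> sets (past n)"
  unfolding past_algebra_def by (subst sets_measure_of) auto

text \<open>No bound on \<open>length u\<close> is required, since the past contains the whole
  tree.\<close>

lemma pred_tree_past: "Measurable.pred (past n) (\<lambda>\<omega>. u \<in> T \<omega>)"
  using past_generators by (auto simp: pred_def)

text \<open>With the length bound inside the predicate, this holds for every word \<open>u\<close>
  and can be used under quantifiers over all words.\<close>

lemma pred_position_past:
  "Measurable.pred (past n) (\<lambda>\<omega>. length u \<le> n \<and> u \<in> T \<omega> \<and> X \<omega> u = x)"
proof (cases "length u \<le> n")
  case True
  then have "{\<omega> \<in> space M. u \<in> T \<omega> \<and> X \<omega> u = x} \<in> sets (past n)"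
    using past_generators[of n] by blast
  then show ?thesis using True by (simp add: pred_def)
qed simp

lemma subalgebra_past_past: "n \<le> k \<Longrightarrow> subalgebra (past k) (past n)"
proof -
  assume "n \<le> k"
  have "sets (past n) \<subseteq> sets (past k)"
    unfolding past_algebra_def
    by (subst (1 2) sets_measure_of, blast, blast, rule sigma_sets_mono')
      (use \<open>n \<le> k\<close> in \<open>fastforce intro: le_trans\<close>)
  then show ?thesis by (simp add: subalgebra_def)
qed

lemma measurable_visits:
  "(\<lambda>\<omega>. visits (T \<omega>) (X \<omega>) n a) \<in> measurable (past n) (count_space {K. finite K})"
proof (rule measurable_finite_set_valued)
  show "Measurable.pred (past n) (\<lambda>\<omega>. u \<in> visits (T \<omega>) (X \<omega>) n a)" for u
    unfolding visits_def mem_Collect_eq by (rule pred_position_past)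
qed (simp add: finite_visits ordered_tree)

text \<open>Adds the redundant facts that the parent is in the tree and in generation at most
  \<open>n\<close>, which makes membership a Boolean combination of conditions known to be
  measurable in the past.\<close>

lemma neighbour_offspring_iff:
  assumes "\<omega> \<in> space M"
  shows "v \<in> neighbour_offspring (T \<omega>) (X \<omega>) n a \<longleftrightarrow>
    v \<in> T \<omega> \<and> length v = Suc n \<and>
    ((length (butlast v) \<le> n \<and> butlast v \<in> T \<omega> \<and> X \<omega> (butlast v) = a - 1) \<or>
     (length (butlast v) \<le> n \<and> butlast v \<in> T \<omega> \<and> X \<omega> (butlast v) = a + 1))"
  using butlast_in_tree[OF ordered_tree[OF assms], of v]
  by (cases "v = []") (auto simp: neighbour_offspring_def)

lemma pred_neighbour_offspring:
  "Measurable.pred (past n) (\<lambda>\<omega>. v \<in> neighbour_offspring (T \<omega>) (X \<omega>) n a)"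
proof -
  have "Measurable.pred (past n) (\<lambda>\<omega>. v \<in> T \<omega> \<and> length v = Suc n \<and>
    ((length (butlast v) \<le> n \<and> butlast v \<in> T \<omega> \<and> X \<omega> (butlast v) = a - 1) \<or>
     (length (butlast v) \<le> n \<and> butlast v \<in> T \<omega> \<and> X \<omega> (butlast v) = a + 1)))"
    by (intro pred_intros_logic pred_tree_past pred_position_past) simp
  then show ?thesis
    by (rule measurable_cong[THEN iffD1, rotated]) (rule neighbour_offspring_iff[symmetric], simp)
qed

lemma measurable_neighbour_offspring:
  "(\<lambda>\<omega>. neighbour_offspring (T \<omega>) (X \<omega>) n a) \<in> measurable (past n) (count_space {K. finite K})"
  by (intro measurable_finite_set_valued pred_neighbour_offspring)
    (simp add: finite_neighbour_offspring ordered_tree)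

lemma measurable_local_time:
  "(\<lambda>\<omega>. local_time (T \<omega>) (X \<omega>) n a) \<in> measurable (past n) (count_space UNIV)"
proof -
  have "(\<lambda>\<omega>. card (visits (T \<omega>) (X \<omega>) n a)) \<in> measurable (past n) (count_space UNIV)"
    by (rule measurable_compose[OF measurable_visits]) simp
  then show ?thesis
    by (rule measurable_cong[THEN iffD1, rotated])
      (simp add: local_time_eq_card_visits ordered_tree)
qed

section \<open>The step law tested against functions of the past\<close>

text \<open>The defining property of conditional expectation applied to \<open>step_law\<close>,
  with \<open>f\<close> as test function. Since all integrands are nonnegative, \<open>f\<close> may
  be unbounded or non-integrable.\<close>

lemma nn_integral_step:
  assumes f: "f \<in> borel_measurable (past n)"
    and A: "finite A" "\<And>v. v \<in> A \<Longrightarrow> length v = Suc n"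
  shows "(\<integral>\<^sup>+\<omega>. f \<omega> * indicator {\<omega> \<in> space M. A \<subseteq> T \<omega> \<and> (\<forall>v\<in>A. X \<omega> v = y v)} \<omega> \<partial>M) =
    (\<integral>\<^sup>+\<omega>. f \<omega> * (indicator {\<omega> \<in> space M. A \<subseteq> T \<omega>} \<omega> *
      ennreal (\<Prod>v\<in>A. step_prob w (local_time (T \<omega>) (X \<omega>) n) (X \<omega> (butlast v)) (y v))) \<partial>M)"
    (is "(\<integral>\<^sup>+\<omega>. f \<omega> * indicator ?E \<omega> \<partial>M) = (\<integral>\<^sup>+\<omega>. f \<omega> * (indicator ?A \<omega> * ennreal (?p \<omega>)) \<partial>M)")
proof -
  interpret F: sigma_finite_subalgebra M "past n"
    using subalgebra_past finite_measure_subalgebra_is_sigma_finite[of M "past n"]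
    by (simp add: finite_measure_subalgebra_def finite_measure_subalgebra_axioms_def finite_measure_axioms)
  have E_eq: "?E = space M \<inter> (\<Inter>v\<in>A. {\<omega> \<in> space M. v \<in> T \<omega> \<and> X \<omega> v = y v})" by auto
  have E [measurable]: "?E \<in> sets M" unfolding E_eq
    using A(1) position_event by (cases "A = {}") (auto intro!: sets.finite_INT)
  have A_eq: "?A = space M \<inter> (\<Inter>v\<in>A. {\<omega> \<in> space M. v \<in> T \<omega>})" by auto
  have Ap [measurable]: "?A \<in> sets (past n)" unfolding A_eq
    using A(1) pred_tree_past[where n = n] sets.top[of "past n"]
    by (cases "A = {}") (auto intro!: sets.finite_INT simp: pred_def)
  have f': "f \<in> borel_measurable M"
    using f by (rule measurable_past)
  let ?g = "\<lambda>\<omega>. ennreal (indicator ?E \<omega> :: real)"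
  \<comment> \<open>A finite bound is needed before passing to real numbers, because
    \<open>enn2real\<close> sends infinity to 0.\<close>
  have "AE \<omega> in M. nn_cond_exp M (past n) ?g \<omega> \<le> nn_cond_exp M (past n) (\<lambda>_. 1) \<omega>"
    by (rule F.nn_cond_exp_mono) (auto simp: indicator_def)
  moreover have "AE \<omega> in M. 1 = nn_cond_exp M (past n) (\<lambda>_. 1) \<omega>"
    by (rule F.nn_cond_exp_F_meas) simp
  ultimately have fin: "AE \<omega> in M. nn_cond_exp M (past n) ?g \<omega> \<le> 1" by eventually_elim simp
  \<comment> \<open>\<open>real_cond_exp\<close> is a difference of positive and negative parts; for
    an indicator the negative part vanishes.\<close>
  have zero: "AE \<omega> in M. nn_cond_exp M (past n) (\<lambda>\<omega>. ennreal (- indicator ?E \<omega>)) \<omega> = 0"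
  proof -
    have "(\<lambda>\<omega>. ennreal (- indicator ?E \<omega>)) = (\<lambda>_. 0)" by (auto simp: indicator_def ennreal_neg)
    then show ?thesis using F.nn_cond_exp_F_meas[of "\<lambda>_. 0"] by (auto elim: AE_mp)
  qed
  have law: "AE \<omega> in M. A \<subseteq> T \<omega> \<longrightarrow> real_cond_exp M (past n) (indicator ?E) \<omega> = ?p \<omega>"
    by (rule step_law[OF A(1)]) (rule A(2))
  have "AE \<omega> in M. f \<omega> * (indicator ?A \<omega> * ennreal (?p \<omega>)) =
      f \<omega> * indicator ?A \<omega> * nn_cond_exp M (past n) ?g \<omega>"
    using fin zero law AE_space
  proof eventually_elim
    case (elim \<omega>)
    show ?case
    proof (cases "A \<subseteq> T \<omega>")
      case True
      have "nn_cond_exp M (past n) ?g \<omega> < top"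
        using elim(1) by (rule le_less_trans) simp
      then have "nn_cond_exp M (past n) ?g \<omega> = ennreal (enn2real (nn_cond_exp M (past n) ?g \<omega>))"
        by (simp only: ennreal_enn2real)
      also have "enn2real (nn_cond_exp M (past n) ?g \<omega>) = ?p \<omega>"
        using elim True by (simp add: real_cond_exp_def)
      finally have "nn_cond_exp M (past n) ?g \<omega> = ennreal (?p \<omega>)" .
      then show ?thesis using True elim by simp
    qed simp
  qed
  then have "(\<integral>\<^sup>+\<omega>. f \<omega> * (indicator ?A \<omega> * ennreal (?p \<omega>)) \<partial>M) =
      (\<integral>\<^sup>+\<omega>. (f \<omega> * indicator ?A \<omega>) * nn_cond_exp M (past n) ?g \<omega> \<partial>M)"
    by (rule nn_integral_cong_AE)
  also have "\<dots> = (\<integral>\<^sup>+\<omega>. (f \<omega> * indicator ?A \<omega>) * ?g \<omega> \<partial>M)"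
  proof (rule F.nn_cond_exp_intg)
    show "(\<lambda>\<omega>. f \<omega> * indicator ?A \<omega>) \<in> borel_measurable (past n)"
      by (intro borel_measurable_times_ennreal borel_measurable_indicator f Ap)
    show "?g \<in> borel_measurable M"
      by (intro measurable_compose[OF borel_measurable_indicator measurable_ennreal] E)
  qed
  also have "\<dots> = (\<integral>\<^sup>+\<omega>. f \<omega> * indicator ?E \<omega> \<partial>M)"
    by (rule nn_integral_cong) (auto simp: indicator_def)
  finally show ?thesis ..
qed

text \<open>For fixed \<open>v\<close>, \<open>x\<close> and \<open>y\<close> with \<open>y\<close>
  not adjacent to \<open>x\<close>, the step law with \<open>A = {v}\<close>, tested against the
  event that the parent is at \<open>x\<close>, gives probability 0. There are only countably many
  such triples.\<close>

lemma AE_nearest_neighbour: "AE \<omega> in M. nearest_neighbour (T \<omega>) (X \<omega>)"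
proof -
  have "AE \<omega> in M. X \<omega> (butlast v) = x \<longrightarrow> v \<in> T \<omega> \<longrightarrow> X \<omega> v \<noteq> y"
    if "v \<noteq> []" and y: "\<not> (y = x - 1 \<or> y = x + 1)" for v x y
  proof -
    define n where "n = length (butlast v)"
    let ?P = "{\<omega> \<in> space M. length (butlast v) \<le> n \<and> butlast v \<in> T \<omega> \<and> X \<omega> (butlast v) = x}"
    let ?E = "{\<omega> \<in> space M. {v} \<subseteq> T \<omega> \<and> (\<forall>v\<in>{v}. X \<omega> v = y)}"
    have P: "?P \<in> sets (past n)"
      using predE[OF pred_position_past] unfolding space_past .
    have P': "?P \<in> sets M" using P by (rule sets_past)
    have E': "?E \<in> sets M" using position_event[of v y] by simp
    have "(\<integral>\<^sup>+\<omega>. indicator ?P \<omega> * indicator ?E \<omega> \<partial>M) = (\<integral>\<^sup>+\<omega>. indicator ?P \<omega> * (indicator {\<omega> \<in> space M. {v} \<subseteq> T \<omega>} \<omega> *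
      ennreal (\<Prod>v\<in>{v}. step_prob w (local_time (T \<omega>) (X \<omega>) n) (X \<omega> (butlast v)) y)) \<partial>M)"
      by (rule nn_integral_step[OF borel_measurable_indicator[OF P]]) (use that(1) in \<open>simp_all add: n_def\<close>)
    also have "\<dots> = (\<integral>\<^sup>+\<omega>. 0 \<partial>M)"
      by (rule nn_integral_cong) (use y in \<open>auto simp: indicator_def step_prob_def\<close>)
    finally have "(\<integral>\<^sup>+\<omega>. indicator ?P \<omega> * indicator ?E \<omega> \<partial>M) = 0" by simp
    then have "AE \<omega> in M. indicator ?P \<omega> * indicator ?E \<omega> = (0::ennreal)"
      by (rule nn_integral_0_iff_AE[THEN iffD1, rotated])
        (intro borel_measurable_times_ennreal borel_measurable_indicator P' E')
    then show ?thesis using AE_space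
    proof eventually_elim
      case (elim \<omega>)
      then show ?case using butlast_in_tree[OF ordered_tree, of \<omega> v] that(1)
        by (auto simp: indicator_def n_def split: if_splits)
    qed
  qed
  then have "AE \<omega> in M. v \<noteq> [] \<longrightarrow> \<not> (y = x - 1 \<or> y = x + 1) \<longrightarrow>
      X \<omega> (butlast v) = x \<longrightarrow> v \<in> T \<omega> \<longrightarrow> X \<omega> v \<noteq> y" for v x y
    by (cases "v \<noteq> [] \<and> \<not> (y = x - 1 \<or> y = x + 1)") (simp, rule AE_I2, blast)
  then have "AE \<omega> in M. \<forall>v x y. v \<noteq> [] \<longrightarrow> \<not> (y = x - 1 \<or> y = x + 1) \<longrightarrow>
      X \<omega> (butlast v) = x \<longrightarrow> v \<in> T \<omega> \<longrightarrow> X \<omega> v \<noteq> y"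
    by (intro AE_all_countable[THEN iffD2] allI)
  then show ?thesis by eventually_elim (auto simp: nearest_neighbour_def)
qed

section \<open>Conditional Borel-Cantelli argument at a fixed site\<close>

text \<open>No candidate escapes from \<open>a\<close> to the other side of its parent. Vacuously
  true when there are no candidates.\<close>

definition inward :: "int \<Rightarrow> nat \<Rightarrow> 'a \<Rightarrow> bool" where
  "inward a n \<omega> \<longleftrightarrow> (\<forall>v \<in> neighbour_offspring (T \<omega>) (X \<omega>) n a. X \<omega> v = a)"

lemma pred_inward: "Measurable.pred (past (Suc n)) (inward a n)"
proof -
  have "Measurable.pred (past (Suc n)) (\<lambda>\<omega>. v \<in> neighbour_offspring (T \<omega>) (X \<omega>) n a)" for v
    by (rule measurable_from_subalg[OF subalgebra_past_past pred_neighbour_offspring]) simp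
  then have "Measurable.pred (past (Suc n)) (\<lambda>\<omega>. \<forall>v. v \<in> neighbour_offspring (T \<omega>) (X \<omega>) n a \<longrightarrow>
      (length v \<le> Suc n \<and> v \<in> T \<omega> \<and> X \<omega> v = a))"
    by (intro pred_intros_countable pred_intros_logic pred_position_past)
  then show ?thesis
    by (rule measurable_cong[THEN iffD1, rotated])
      (auto simp: inward_def neighbour_offspring_def)
qed

text \<open>Each candidate misses \<open>a\<close> with conditional probability at least the
  displayed fraction, so this is a lower bound for the conditional expected number of
  escapes.\<close>

definition escape_rate :: "int \<Rightarrow> nat \<Rightarrow> 'a \<Rightarrow> real" where
  "escape_rate a n \<omega> = real (card (neighbour_offspring (T \<omega>) (X \<omega>) n a)) *
     (w 0 / (w 0 + w (local_time (T \<omega>) (X \<omega>) n a)))"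

lemma measurable_escape_rate: "escape_rate a n \<in> borel_measurable (past n)"
proof -
  note [measurable] = measurable_local_time
  have [measurable]: "(\<lambda>\<omega>. card (neighbour_offspring (T \<omega>) (X \<omega>) n a)) \<in> measurable (past n) (count_space UNIV)"
    by (rule measurable_compose[OF measurable_neighbour_offspring]) simp
  show ?thesis unfolding escape_rate_def by measurable
qed

text \<open>Given the past, the candidates step independently, and each hits \<open>a\<close> with
  probability at most \<open>exp (- r)\<close>, where \<open>r\<close> is the fraction in
  \<open>escape_rate\<close>. As \<open>step_law\<close> concerns deterministic sets of vertices,
  the integral is first split according to the value \<open>K\<close> of the random set of
  candidates.\<close>

lemma nn_integral_inward_le:
  assumes weight: "mono w" "\<And>n. w n > 0" and f: "f \<in> borel_measurable (past n)"
  shows "(\<integral>\<^sup>+\<omega>. f \<omega> * indicator {\<omega> \<in> space M. inward a n \<omega>} \<omega> \<partial>M) \<le>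
    (\<integral>\<^sup>+\<omega>. f \<omega> * ennreal (exp (- escape_rate a n \<omega>)) \<partial>M)"
proof -
  define B where "B \<omega> = neighbour_offspring (T \<omega>) (X \<omega>) n a" for \<omega>
  define \<K> where "\<K> = {K :: nat list set. finite K \<and> (\<forall>v\<in>K. length v = Suc n)}"
  define Q where "Q K = {\<omega> \<in> space M. B \<omega> = K}" for K
  let ?I = "{\<omega> \<in> space M. inward a n \<omega>}"
  have cnt: "countable \<K>"
    by (rule countable_subset[OF _ countable_Collect_finite]) (auto simp: \<K>_def)
  have Q: "Q K \<in> sets (past n)" if "K \<in> \<K>" for K
  proof -
    have "Q K = B -` {K} \<inter> space (past n)" by (auto simp: Q_def)
    also have "\<dots> \<in> sets (past n)" unfolding B_def
      by (rule measurable_sets[OF measurable_neighbour_offspring]) (use that in \<open>auto simp: \<K>_def\<close>)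
    finally show ?thesis .
  qed
  have Q': "Q K \<in> sets M" if "K \<in> \<K>" for K
    using Q[OF that] by (rule sets_past)
  have B\<K>: "B \<omega> \<in> \<K>" if "\<omega> \<in> space M" for \<omega>
    using finite_neighbour_offspring[OF ordered_tree[OF that]]
    by (auto simp: \<K>_def B_def neighbour_offspring_def)
  \<comment> \<open>The events \<open>Q K\<close> partition the space into countably many pieces, so
    exactly one summand survives at each point.\<close>
  have split: "(\<integral>\<^sup>+\<omega>. g \<omega> \<partial>M) = (\<integral>\<^sup>+K. (\<integral>\<^sup>+\<omega>. g \<omega> * indicator (Q K) \<omega> \<partial>M) \<partial>count_space \<K>)"
    if "g \<in> borel_measurable M" for g :: "'a \<Rightarrow> ennreal"
  proof -
    have "(\<integral>\<^sup>+\<omega>. g \<omega> \<partial>M) = (\<integral>\<^sup>+\<omega>. (\<integral>\<^sup>+K. g \<omega> * indicator (Q K) \<omega> \<partial>count_space \<K>) \<partial>M)"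
    proof (rule nn_integral_cong)
      fix \<omega> assume \<omega>: "\<omega> \<in> space M"
      have "(\<integral>\<^sup>+K. g \<omega> * indicator (Q K) \<omega> \<partial>count_space \<K>) = (\<Sum>K\<in>{B \<omega>}. g \<omega> * indicator (Q K) \<omega>)"
        by (rule nn_integral_count_space') (use B\<K>[OF \<omega>] in \<open>auto simp: Q_def\<close>)
      then show "g \<omega> = (\<integral>\<^sup>+K. g \<omega> * indicator (Q K) \<omega> \<partial>count_space \<K>)"
        using \<omega> by (simp add: Q_def)
    qed
    also have "\<dots> = (\<integral>\<^sup>+K. (\<integral>\<^sup>+\<omega>. g \<omega> * indicator (Q K) \<omega> \<partial>M) \<partial>count_space \<K>)"
      by (rule nn_integral_count_space_nn_integral[OF cnt])
        (intro borel_measurable_times_ennreal borel_measurable_indicator that Q')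
    finally show ?thesis .
  qed
  have f': "f \<in> borel_measurable M"
    using f by (rule measurable_past)
  have I': "?I \<in> sets M"
    by (rule predE[OF measurable_past[OF pred_inward]])
  have h': "escape_rate a n \<in> borel_measurable M"
    by (rule measurable_past[OF measurable_escape_rate])
  have K: "(\<integral>\<^sup>+\<omega>. f \<omega> * indicator ?I \<omega> * indicator (Q K) \<omega> \<partial>M) \<le>
      (\<integral>\<^sup>+\<omega>. f \<omega> * ennreal (exp (- escape_rate a n \<omega>)) * indicator (Q K) \<omega> \<partial>M)" if "K \<in> \<K>" for K
  proof -
    let ?E = "{\<omega> \<in> space M. K \<subseteq> T \<omega> \<and> (\<forall>v\<in>K. X \<omega> v = a)}"
    let ?p = "\<lambda>\<omega>. \<Prod>v\<in>K. step_prob w (local_time (T \<omega>) (X \<omega>) n) (X \<omega> (butlast v)) a"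
    have "(\<integral>\<^sup>+\<omega>. f \<omega> * indicator ?I \<omega> * indicator (Q K) \<omega> \<partial>M) =
        (\<integral>\<^sup>+\<omega>. (f \<omega> * indicator (Q K) \<omega>) * indicator ?E \<omega> \<partial>M)"
    proof (rule nn_integral_cong)
      fix \<omega> assume \<omega>: "\<omega> \<in> space M"
      have "inward a n \<omega> \<longleftrightarrow> \<omega> \<in> ?E" if K: "B \<omega> = K"
        unfolding inward_def K[symmetric] B_def using \<omega> by (auto simp: neighbour_offspring_def)
      then show "f \<omega> * indicator ?I \<omega> * indicator (Q K) \<omega> = f \<omega> * indicator (Q K) \<omega> * indicator ?E \<omega>"
        using \<omega> by (cases "B \<omega> = K") (simp_all add: Q_def indicator_def)
    qed
    also have "\<dots> = (\<integral>\<^sup>+\<omega>. (f \<omega> * indicator (Q K) \<omega>) *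
        (indicator {\<omega> \<in> space M. K \<subseteq> T \<omega>} \<omega> * ennreal (?p \<omega>)) \<partial>M)"
    proof (rule nn_integral_step)
      show "(\<lambda>\<omega>. f \<omega> * indicator (Q K) \<omega>) \<in> borel_measurable (past n)"
        by (intro borel_measurable_times_ennreal borel_measurable_indicator f Q that)
    qed (use that in \<open>auto simp: \<K>_def\<close>)
    also have "\<dots> \<le> (\<integral>\<^sup>+\<omega>. f \<omega> * ennreal (exp (- escape_rate a n \<omega>)) * indicator (Q K) \<omega> \<partial>M)"
    proof (rule nn_integral_mono)
      fix \<omega> assume \<omega>: "\<omega> \<in> space M"
      show "(f \<omega> * indicator (Q K) \<omega>) * (indicator {\<omega> \<in> space M. K \<subseteq> T \<omega>} \<omega> * ennreal (?p \<omega>)) \<le>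
          f \<omega> * ennreal (exp (- escape_rate a n \<omega>)) * indicator (Q K) \<omega>"
      proof (cases "B \<omega> = K")
        case True
        let ?r = "w 0 / (w 0 + w (local_time (T \<omega>) (X \<omega>) n a))"
        \<comment> \<open>Every \<open>v\<close> in \<open>K\<close> has its parent next to
          \<open>a\<close>, so \<open>step_prob_le_exp\<close> bounds each factor by the same
          number.\<close>
        have "?p \<omega> \<le> (\<Prod>v\<in>K. exp (- ?r))"
        proof (rule prod_mono, rule conjI)
          fix v assume v: "v \<in> K"
          show "0 \<le> step_prob w (local_time (T \<omega>) (X \<omega>) n) (X \<omega> (butlast v)) a"
            using weight(2) by (auto simp: step_prob_def less_imp_le intro!: divide_nonneg_nonneg add_nonneg_nonneg)
          show "step_prob w (local_time (T \<omega>) (X \<omega>) n) (X \<omega> (butlast v)) a \<le> exp (- ?r)"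
            using v True by (intro step_prob_le_exp weight) (auto simp: B_def neighbour_offspring_def)
        qed
        also have "\<dots> = exp (- escape_rate a n \<omega>)"
          using True by (simp add: escape_rate_def B_def exp_of_nat_mult[symmetric])
        finally have "ennreal (?p \<omega>) \<le> ennreal (exp (- escape_rate a n \<omega>))" by (rule ennreal_leI)
        then show ?thesis using True \<omega>
          by (auto simp: Q_def B_def neighbour_offspring_def intro!: mult_left_mono)
      qed (simp add: Q_def)
    qed
    finally show ?thesis .
  qed
  have "(\<integral>\<^sup>+\<omega>. f \<omega> * indicator ?I \<omega> \<partial>M) =
      (\<integral>\<^sup>+K. (\<integral>\<^sup>+\<omega>. f \<omega> * indicator ?I \<omega> * indicator (Q K) \<omega> \<partial>M) \<partial>count_space \<K>)"
    by (intro split borel_measurable_times_ennreal borel_measurable_indicator f' I')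
  also have "\<dots> \<le> (\<integral>\<^sup>+K. (\<integral>\<^sup>+\<omega>. f \<omega> * ennreal (exp (- escape_rate a n \<omega>)) * indicator (Q K) \<omega> \<partial>M) \<partial>count_space \<K>)"
    by (rule nn_integral_mono) (simp only: space_count_space K)
  also have "\<dots> = (\<integral>\<^sup>+\<omega>. f \<omega> * ennreal (exp (- escape_rate a n \<omega>)) \<partial>M)"
    using h' by (intro split[symmetric] borel_measurable_times_ennreal f') measurable
  finally show ?thesis .
qed

text \<open>The exponential of the accumulated rates, killed at the first escape, is a nonnegative
  supermartingale started at 1. By Fatou its liminf is almost surely finite, whereas it would be
  infinite if the rates diverged without any escape.\<close>

lemma AE_inward_imp_not_diverging:
  assumes weight: "mono w" "\<And>n. w n > 0"
  shows "AE \<omega> in M. (\<forall>n\<ge>m. inward a n \<omega>) \<longrightarrow>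
    \<not> filterlim (\<lambda>k. \<Sum>n = m..<k. escape_rate a n \<omega>) at_top sequentially"
proof -
  define W where "W k \<omega> = ennreal (exp (\<Sum>n = m..<m + k. escape_rate a n \<omega>)) *
     indicator {\<omega> \<in> space M. \<forall>n\<in>{m..<m + k}. inward a n \<omega>} \<omega>" for k \<omega>
  have W_meas: "W k \<in> borel_measurable (past (m + k))" for k
  proof -
    have e: "escape_rate a n \<in> borel_measurable (past (m + k))" if "n \<in> {m..<m + k}" for n
      by (rule measurable_from_subalg[OF subalgebra_past_past measurable_escape_rate])
        (use that in simp)
    have i: "Measurable.pred (past (m + k)) (inward a n)" if "n \<in> {m..<m + k}" for n
      by (rule measurable_from_subalg[OF subalgebra_past_past pred_inward]) (use that in simp)
    have "Measurable.pred (past (m + k)) (\<lambda>\<omega>. \<forall>n\<in>{m..<m + k}. inward a n \<omega>)"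
      by (intro pred_intros_finite i) simp_all
    then have "{\<omega> \<in> space M. \<forall>n\<in>{m..<m + k}. inward a n \<omega>} \<in> sets (past (m + k))"
      using predE unfolding space_past[of "m + k", symmetric] by blast
    moreover have "(\<lambda>\<omega>. ennreal (exp (\<Sum>n = m..<m + k. escape_rate a n \<omega>))) \<in>
        borel_measurable (past (m + k))"
      by (rule measurable_compose[OF borel_measurable_sum[OF e]]) measurable
    ultimately show ?thesis
      unfolding W_def by (intro borel_measurable_times_ennreal borel_measurable_indicator)
  qed
  have W_meas': "W k \<in> borel_measurable M" for k
    by (rule measurable_past[OF W_meas])
  have W_le: "(\<integral>\<^sup>+\<omega>. W k \<omega> \<partial>M) \<le> 1" for k
  proof (induction k)
    case 0
    then show ?case by (simp add: W_def emeasure_space_1)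
  next
    case (Suc k)
    let ?e = "\<lambda>\<omega>. escape_rate a (m + k) \<omega>"
    have "(\<integral>\<^sup>+\<omega>. W (Suc k) \<omega> \<partial>M) = (\<integral>\<^sup>+\<omega>. (W k \<omega> * ennreal (exp (?e \<omega>))) *
        indicator {\<omega> \<in> space M. inward a (m + k) \<omega>} \<omega> \<partial>M)"
      by (rule nn_integral_cong)
        (auto simp: W_def indicator_def exp_add ennreal_mult less_Suc_eq)
    \<comment> \<open>The factor \<open>W k * exp ?e\<close> belongs to the past of generation
      \<open>m + k\<close>, so it may serve as test function; the bound \<open>exp (- ?e)\<close>
      then cancels the new factor exactly.\<close>
    also have "\<dots> \<le> (\<integral>\<^sup>+\<omega>. (W k \<omega> * ennreal (exp (?e \<omega>))) * ennreal (exp (- ?e \<omega>)) \<partial>M)"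
      by (intro nn_integral_inward_le weight borel_measurable_times_ennreal W_meas
          measurable_compose[OF measurable_escape_rate]) measurable
    also have "\<dots> = (\<integral>\<^sup>+\<omega>. W k \<omega> \<partial>M)"
      by (rule nn_integral_cong)
        (simp add: mult.assoc ennreal_mult[symmetric] exp_add[symmetric])
    finally show ?case using Suc by (rule order_trans)
  qed
  have "(\<integral>\<^sup>+\<omega>. liminf (\<lambda>k. W k \<omega>) \<partial>M) \<le> liminf (\<lambda>k. (\<integral>\<^sup>+\<omega>. W k \<omega> \<partial>M))"
    by (rule nn_integral_liminf) (rule W_meas')
  also have "\<dots> \<le> liminf (\<lambda>k. 1 :: ennreal)"
    using W_le by (intro Liminf_mono) auto
  also have "\<dots> = 1" by (rule Liminf_const) simp
  finally have "(\<integral>\<^sup>+\<omega>. liminf (\<lambda>k. W k \<omega>) \<partial>M) \<noteq> \<infinity>" by (auto simp: top_unique)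
  then have "AE \<omega> in M. liminf (\<lambda>k. W k \<omega>) \<noteq> \<infinity>"
    by (intro nn_integral_PInf_AE borel_measurable_liminf W_meas')
  then show ?thesis using AE_space
  proof eventually_elim
    case (elim \<omega>)
    show ?case
    proof (intro impI notI)
      assume inw: "\<forall>n\<ge>m. inward a n \<omega>"
        and lim: "filterlim (\<lambda>k. \<Sum>n = m..<k. escape_rate a n \<omega>) at_top sequentially"
      have "filterlim (\<lambda>k. \<Sum>n = m..<m + k. escape_rate a n \<omega>) at_top sequentially"
        by (rule filterlim_compose[OF lim]) (rule filterlim_subseq, simp add: strict_mono_def)
      then have "filterlim (\<lambda>k. exp (\<Sum>n = m..<m + k. escape_rate a n \<omega>)) at_top sequentially"
        by (rule filterlim_compose[OF exp_at_top])
      then have "((\<lambda>k. ennreal (exp (\<Sum>n = m..<m + k. escape_rate a n \<omega>))) \<longlongrightarrow> \<infinity>) sequentially"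
        by (simp add: ennreal_tendsto_top_eq_at_top)
      \<comment> \<open>Without any escape the indicator in \<open>W\<close> is always 1.\<close>
      then have "((\<lambda>k. W k \<omega>) \<longlongrightarrow> \<infinity>) sequentially"
        using inw elim by (simp add: W_def)
      then have "liminf (\<lambda>k. W k \<omega>) = \<infinity>" by (intro lim_imp_Liminf) simp_all
      then show False using elim by simp
    qed
  qed
qed

section \<open>Divergence of the rates and visits at distance two\<close>

text \<open>The local time at \<open>a\<close> runs to infinity and each unit of its growth is paid
  for by a candidate, so the accumulated rates dominate the divergent series of \<open>g\<close> by
  \<open>sum_le_antimono_partial_sums\<close>.\<close>

lemma filterlim_sum_escape_rate:
  assumes weight: "mono w" "\<And>n. w n > 0" and div: "\<not> summable (\<lambda>n. 1 / w n)"
    and \<omega>: "\<omega> \<in> space M" "nearest_neighbour (T \<omega>) (X \<omega>)" "a \<in> infinitely_visited (T \<omega>) (X \<omega>)"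
  shows "filterlim (\<lambda>k. \<Sum>n = m..<k. escape_rate a n \<omega>) at_top sequentially"
proof -
  define g where "g k = w 0 / (w 0 + w k)" for k
  define z where "z n = local_time (T \<omega>) (X \<omega>) n a" for n
  have g0: "g k \<ge> 0" for k
    using weight(2)[of 0] weight(2)[of k] by (simp add: g_def)
  have g_anti: "antimono g"
    unfolding g_def using weight
    by (intro antimonoI divide_left_mono mult_pos_pos add_pos_pos) (auto simp: less_imp_le dest: monoD)
  have "\<not> summable g"
  proof
    assume "summable g"
    \<comment> \<open>As \<open>w 0 <= w k\<close>, the denominator of \<open>g k\<close> is at most
      \<open>2 * w k\<close>, whence the constant \<open>2 / w 0\<close>.\<close>
    then have "summable (\<lambda>k. 2 / w 0 * g k)" by (rule summable_mult)
    then have "summable (\<lambda>k. 1 / w k)"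
    proof (rule summable_comparison_test'[where N = 0])
      fix k :: nat
      have "w 0 \<le> w k" using weight(1) by (auto dest: monoD)
      then show "norm (1 / w k) \<le> 2 / w 0 * g k"
        using weight(2)[of 0] weight(2)[of k] by (simp add: g_def field_simps)
    qed
    with div show False by simp
  qed
  have "filterlim (\<lambda>k. \<Sum>j<k. g j) at_top sequentially"
    unfolding filterlim_at_top
  proof
    fix Z
    have "\<not> (\<forall>n. (\<Sum>j<n. g j) \<le> Z)"
      using \<open>\<not> summable g\<close> summableI_nonneg_bounded[of g Z] g0 by blast
    then obtain n where n: "Z < (\<Sum>j<n. g j)" by (auto simp: not_le)
    show "\<forall>\<^sub>F k in sequentially. Z \<le> (\<Sum>j<k. g j)"
    proof (rule eventually_sequentiallyI)
      fix k assume "n \<le> k"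
      then have "(\<Sum>j<n. g j) \<le> (\<Sum>j<k. g j)" using g0 by (intro sum_mono2) auto
      with n show "Z \<le> (\<Sum>j<k. g j)" by simp
    qed
  qed
  then have "filterlim (\<lambda>k. \<Sum>j<z k. g j) at_top sequentially"
    by (rule filterlim_compose) (use filterlim_local_time[OF ordered_tree] \<omega> in \<open>simp add: z_def\<close>)
  \<comment> \<open>Dropping the fixed number of terms before generation \<open>m\<close> does not
    affect divergence.\<close>
  then have "filterlim (\<lambda>k. - (\<Sum>j<z m. g j) + (\<Sum>j<z k. g j)) at_top sequentially"
    by (rule filterlim_tendsto_add_at_top[OF tendsto_const])
  then show ?thesis
  proof (rule filterlim_at_top_mono, intro eventually_sequentiallyI[of m])
    fix k assume k: "m \<le> k"
    have z_Suc: "z n \<le> z (Suc n)" for n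
      unfolding z_def by (rule local_time_mono[OF ordered_tree[OF \<omega>(1)]])
    have "z m \<le> z k" using k z_Suc by (rule lift_Suc_mono_le[rotated])
    then have "- (\<Sum>j<z m. g j) + (\<Sum>j<z k. g j) = (\<Sum>j = z m..<z k. g j)"
      using sum.atLeastLessThan_concat[of 0 "z m" "z k" g] by (simp add: atLeast0LessThan)
    also have "\<dots> \<le> (\<Sum>n = m..<k. real (card (neighbour_offspring (T \<omega>) (X \<omega>) n a)) * g (z n))"
    proof (rule sum_le_antimono_partial_sums)
      show "z (Suc n) \<le> z n + card (neighbour_offspring (T \<omega>) (X \<omega>) n a)" for n
        unfolding z_def by (rule local_time_Suc_le[OF ordered_tree[OF \<omega>(1)] \<omega>(2)])
    qed (use g_anti g0 z_Suc k in auto)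
    also have "\<dots> = (\<Sum>n = m..<k. escape_rate a n \<omega>)"
      by (simp add: escape_rate_def g_def z_def)
    finally show "- (\<Sum>j<z m. g j) + (\<Sum>j<z k. g j) \<le> (\<Sum>n = m..<k. escape_rate a n \<omega>)" .
  qed
qed

text \<open>If neither \<open>a - 2\<close> nor \<open>a + 2\<close> were visited infinitely often,
  all late candidates would step onto \<open>a\<close>, so every late generation would be inward
  although the rates diverge.\<close>

lemma AE_second_neighbour_infinitely_visited:
  assumes weight: "mono w" "\<And>n. w n > 0" and div: "\<not> summable (\<lambda>n. 1 / w n)"
  shows "AE \<omega> in M. \<forall>a \<in> infinitely_visited (T \<omega>) (X \<omega>).
    a - 2 \<in> infinitely_visited (T \<omega>) (X \<omega>) \<or> a + 2 \<in> infinitely_visited (T \<omega>) (X \<omega>)"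
proof -
  \<comment> \<open>The exceptional null set must not depend on \<open>a\<close> or
    \<open>m\<close>, since both are chosen from the realisation below.\<close>
  have "AE \<omega> in M. \<forall>a m. (\<forall>n\<ge>m. inward a n \<omega>) \<longrightarrow>
      \<not> filterlim (\<lambda>k. \<Sum>n = m..<k. escape_rate a n \<omega>) at_top sequentially"
    unfolding AE_all_countable using AE_inward_imp_not_diverging[OF weight] by blast
  then show ?thesis using AE_nearest_neighbour AE_space
  proof eventually_elim
    case (elim \<omega>)
    note t = ordered_tree[OF elim(3)]
    show ?case
    proof (rule ballI, rule ccontr)
      fix a assume a: "a \<in> infinitely_visited (T \<omega>) (X \<omega>)"
        and "\<not> (a - 2 \<in> infinitely_visited (T \<omega>) (X \<omega>) \<or> a + 2 \<in> infinitely_visited (T \<omega>) (X \<omega>))"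
      then obtain n m where
        n: "\<And>u. u \<in> T \<omega> \<Longrightarrow> X \<omega> u = a - 2 \<Longrightarrow> length u < n" and
        m: "\<And>u. u \<in> T \<omega> \<Longrightarrow> X \<omega> u = a + 2 \<Longrightarrow> length u < m"
        unfolding infinitely_visited_iff infinite_iff_unbounded_generation[OF t]
        by (meson not_le)
      have "inward a k \<omega>" if "k \<ge> n + m" for k
        unfolding inward_def
      proof
        fix v assume v: "v \<in> neighbour_offspring (T \<omega>) (X \<omega>) k a"
        then have "v \<noteq> []" "v \<in> T \<omega>" "length v = Suc k" by (auto simp: neighbour_offspring_def)
        then have "X \<omega> v = X \<omega> (butlast v) - 1 \<or> X \<omega> v = X \<omega> (butlast v) + 1"
          using elim(2) by (auto simp: nearest_neighbour_def)
        moreover have "X \<omega> v \<noteq> a - 2" "X \<omega> v \<noteq> a + 2"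
          using n[OF \<open>v \<in> T \<omega>\<close>] m[OF \<open>v \<in> T \<omega>\<close>] \<open>length v = Suc k\<close> that by auto
        ultimately show "X \<omega> v = a" using v by (auto simp: neighbour_offspring_def)
      qed
      then show False
        using elim(1) filterlim_sum_escape_rate[OF weight div elim(3,2) a, of "n + m"] by blast
    qed
  qed
qed

text \<open>The random set of sites may be infinite, but the event only involves its finite values,
  of which there are countably many.\<close>

lemma card_infinitely_visited_event:
  "{\<omega> \<in> space M. card (infinitely_visited (T \<omega>) (X \<omega>)) \<in> {2, 3}} \<in> sets M"
proof -
  have [measurable]: "Measurable.pred M (\<lambda>\<omega>. u \<in> T \<omega> \<and> X \<omega> u = y)" for u y
    using position_event by (simp add: pred_def)
  have [measurable]: "Measurable.pred M (\<lambda>\<omega>. y \<in> infinitely_visited (T \<omega>) (X \<omega>))" for y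
  proof -
    have "Measurable.pred M (\<lambda>\<omega>. \<forall>n. \<exists>u. (u \<in> T \<omega> \<and> X \<omega> u = y) \<and> n \<le> length u)" by measurable
    then show ?thesis
      by (rule measurable_cong[THEN iffD1, rotated])
        (simp add: infinitely_visited_iff infinite_iff_unbounded_generation[OF ordered_tree] Bex_def)
  qed
  have "{\<omega> \<in> space M. card (infinitely_visited (T \<omega>) (X \<omega>)) \<in> {2, 3}} =
    (\<Union>K \<in> {K. finite K \<and> card K \<in> {2, 3}}.
      {\<omega> \<in> space M. \<forall>y. y \<in> infinitely_visited (T \<omega>) (X \<omega>) \<longleftrightarrow> y \<in> K})" (is "_ = \<Union> (?E ` ?\<K>)")
  proof (intro set_eqI iffI)
    fix \<omega> assume \<omega>: "\<omega> \<in> {\<omega> \<in> space M. card (infinitely_visited (T \<omega>) (X \<omega>)) \<in> {2, 3}}"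
    \<comment> \<open>An infinite set has \<open>card\<close> equal to 0, which is excluded
      here.\<close>
    then have "finite (infinitely_visited (T \<omega>) (X \<omega>))" by (intro card_ge_0_finite) auto
    with \<omega> show "\<omega> \<in> \<Union> (?E ` ?\<K>)" by (intro UN_I[of "infinitely_visited (T \<omega>) (X \<omega>)"]) auto
  next
    fix \<omega> assume "\<omega> \<in> \<Union> (?E ` ?\<K>)"
    then obtain K where "card K \<in> {2, 3}" "\<omega> \<in> space M" "infinitely_visited (T \<omega>) (X \<omega>) = K"
      by blast
    then show "\<omega> \<in> {\<omega> \<in> space M. card (infinitely_visited (T \<omega>) (X \<omega>)) \<in> {2, 3}}" by auto
  qed
  also have "\<dots> \<in> sets M"
  proof (rule sets.countable_UN'')
    show "countable ?\<K>" by (rule countable_subset[OF _ countable_Collect_finite]) auto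
  qed measurable
  finally show ?thesis .
qed

end

theorem proposition1p2:
  fixes M :: "'a measure"
    and \<mu> :: "nat pmf"
    and \<sigma>2 :: real
    and w :: "nat \<Rightarrow> real"
    and T S :: "'a \<Rightarrow> nat list set"
    and X :: "'a \<Rightarrow> nat list \<Rightarrow> int"
  assumes mean: "(\<lambda>i. real i * pmf \<mu> i) sums 1"
    and variance: "(\<lambda>i. real i * (real i - 1) * pmf \<mu> i) sums \<sigma>2" "\<sigma>2 > 0"
    and weight: "mono w" "\<And>n. w n > 0"
    and walk: "vrbrw M \<mu> T S w X"
    and divergence: "\<not> summable (\<lambda>n. 1 / w n)"
  shows "{\<omega> \<in> space M. card (infinitely_visited (T \<omega>) (X \<omega>)) \<in> {2, 3}} \<in> sets M \<and>
         measure M {\<omega> \<in> space M. card (infinitely_visited (T \<omega>) (X \<omega>)) \<in> {2, 3}} = 0"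
proof -
  interpret vrbrw M \<mu> T S w X by (rule walk)
  let ?E = "{\<omega> \<in> space M. card (infinitely_visited (T \<omega>) (X \<omega>)) \<in> {2, 3}}"
  have "AE \<omega> in M. \<omega> \<notin> ?E"
    using AE_nearest_neighbour AE_second_neighbour_infinitely_visited[OF weight divergence] AE_space
  proof eventually_elim
    case (elim \<omega>)
    have "card (infinitely_visited (T \<omega>) (X \<omega>)) \<notin> {2, 3}"
      by (rule card_closed_neighbours_not_2_3)
        (erule neighbour_infinitely_visited[OF ordered_tree[OF elim(3)] elim(1)], erule bspec[OF elim(2)])
    then show ?case by blast
  qed
  \<comment> \<open>Measurability gives the second claim its meaning: \<open>measure\<close> is 0 by
    default on non-measurable sets.\<close>
  then show ?thesis
    using prob_eq_0[OF card_infinitely_visited_event] card_infinitely_visited_event by blast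
qed

end
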